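(* Let $N_{\rm RF},N_u\ge 1$ be integers, $p_u>0$, $c>0$, $f_s>0$, $\bar b>0$, and let ${\bf H}_{\rm b}\in\mathbb{C}^{N_{\rm RF}\times N_u}$ have rows $[{\bf H}_{\rm b}]_{i,:}$ with $\|[{\bf H}_{\rm b}]_{i,:}\|\ne0$ for $i=1,\dots,N_{\rm RF}$. Put $\sigma_{x_i}^2=p_u\|[{\bf H}_{\rm b}]_{i,:}\|^2$. Consider the revised minimum mean square quantization error problem $$\hat{\mathbf b}^{rev}=\arg\min_{\mathbf b=[b_1,\dots,b_{N_{\rm RF}}]^{\top}\in\mathbb{R}^{N_{\rm RF}}}\ \sum_{i=1}^{N_{\rm RF}}\mathcal{E}_{x_i}(b_i)\quad\text{subject to}\quad \sum_{i=1}^{N_{\rm RF}}P_{\rm ADC}(b_i)\le N_{\rm RF}\,P_{\rm ADC}(\bar b),$$ where, for all $b\in\mathbb{R}$, $\mathcal{E}_{x_i}(b)=\frac{\pi\sqrt3}{2}\,\sigma_{x_i}^2\,2^{-2b}$ and $P_{\rm ADC}(b)=c\,f_s\,2^{b}$. Then the optimal solution of this problem is $$\hat b_i^{rev}=\bar b+\log_2\left(\frac{N_{\rm RF}\,\|[{\bf H}_{\rm b}]_{i,:}\|^{2/3}}{\sum_{j=1}^{N_{\rm RF}}\|[{\bf H}_{\rm b}]_{j,:}\|^{2/3}}\right),\qquad i=1,\dots,N_{\rm RF}.$$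
   Context: $\|\cdot\|$ is the Euclidean norm. The setting is a receiver with $N_{\rm RF}$ RF chains, where the $i$-th chain's analog-to-digital converter (ADC) pair uses $b_i$ bits (relaxed to real numbers); $\mathcal{E}_{x_i}$ models the mean square quantization error of the $i$-th desired (noise-free) signal, $P_{\rm ADC}$ models the ADC power consumption, and $\bar b$ is a reference number of bits fixing the total power budget. *)

theory Defs
  imports "HOL-Analysis.Analysis"
begin

(* The channel matrix H has type complex^'u^'r, with one row per RF chain; hence
   N_RF = CARD('r) and N_u = CARD('u).  The norm on complex^'u is the Euclidean one. *)

definition signal_variance :: "real \<Rightarrow> complex^'u^'r \<Rightarrow> 'r \<Rightarrow> real" where
  "signal_variance p H i = p * (norm (row i H))\<^sup>2"

definition quant_error :: "real \<Rightarrow> complex^'u^'r \<Rightarrow> 'r \<Rightarrow> real \<Rightarrow> real" where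
  "quant_error p H i b = (pi * sqrt 3 / 2) * signal_variance p H i * 2 powr (- 2 * b)"

definition adc_power :: "real \<Rightarrow> real \<Rightarrow> real \<Rightarrow> real" where
  "adc_power c fs b = c * fs * 2 powr b"

definition total_quant_error :: "real \<Rightarrow> complex^'u^'r \<Rightarrow> real^'r \<Rightarrow> real" where
  "total_quant_error p H b = (\<Sum>i\<in>UNIV. quant_error p H i (b $ i))"

definition within_power_budget :: "real \<Rightarrow> real \<Rightarrow> real \<Rightarrow> real^'r \<Rightarrow> bool" where
  "within_power_budget c fs bbar b \<longleftrightarrow>
     (\<Sum>i\<in>UNIV. adc_power c fs (b $ i)) \<le> real CARD('r) * adc_power c fs bbar"

end

theory Submission
  imports Defs
begin

text \<open>
  Write \<open>x\<^sub>i = 2 powr b\<^sub>i\<close> and let \<open>y\<^sub>i\<close> be its value at the claimed optimum.  Since \<open>y\<^sub>i\<close> is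
  proportional to the 2/3-power of the norm of row \<open>i\<close>, the objective is a positive multiple of
  the sum of \<open>y\<^sub>i^3 / x\<^sub>i^2\<close>, while the budget reads \<open>\<Sum> x\<^sub>i \<le> \<Sum> y\<^sub>i\<close>.  The tangent line of
  \<open>x \<mapsto> y^3 / x^2\<close> at \<open>x = y\<close> has slope \<open>-2\<close> whatever \<open>y\<close> is, so summing the tangent
  inequalities \<open>y^3 / x^2 \<ge> 3 y - 2 x\<close> gives optimality, and strict convexity gives uniqueness.
\<close>

text \<open>After clearing the denominator, the gap factors as
  \<open>(x - y)\<^sup>2 * (2 * x + y)\<close>; the double root at \<open>x = y\<close> expresses
  tangency.\<close>

lemma cube_div_square_gt_tangent:
  fixes x y :: real
  assumes "x > 0" "y > 0" "x \<noteq> y"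
  shows "3 * y - 2 * x < y ^ 3 / x\<^sup>2"
proof -
  have "y ^ 3 - (3 * y - 2 * x) * x\<^sup>2 = (x - y)\<^sup>2 * (2 * x + y)"
    by (simp add: algebra_simps power2_eq_square power3_eq_cube)
  also have "\<dots> > 0"
    using assms by simp
  finally show ?thesis
    using \<open>x > 0\<close> by (simp add: pos_less_divide_eq)
qed

text \<open>The common slope -2 makes the tangent lines add up to
  \<open>3 * sum y I - 2 * sum x I\<close>, so only the totals matter; a single index with
  \<open>x i \<noteq> y i\<close> gives strictness.\<close>

lemma sum_less_sum_cube_div_square:
  fixes x y :: "'a \<Rightarrow> real"
  assumes "finite I"
    and pos: "\<And>i. i \<in> I \<Longrightarrow> x i > 0" "\<And>i. i \<in> I \<Longrightarrow> y i > 0"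
    and le: "sum x I \<le> sum y I"
    and ne: "\<exists>i\<in>I. x i \<noteq> y i"
  shows "sum y I < (\<Sum>i\<in>I. y i ^ 3 / (x i)\<^sup>2)"
proof -
  have "sum y I \<le> (\<Sum>i\<in>I. 3 * y i - 2 * x i)"
    using le by (simp add: sum_subtractf flip: sum_distrib_left)
  also have "\<dots> < (\<Sum>i\<in>I. y i ^ 3 / (x i)\<^sup>2)"
  proof (rule sum_strict_mono_ex1)
    show "\<forall>i\<in>I. 3 * y i - 2 * x i \<le> y i ^ 3 / (x i)\<^sup>2"
    proof
      fix i assume "i \<in> I"
      then show "3 * y i - 2 * x i \<le> y i ^ 3 / (x i)\<^sup>2"
        using cube_div_square_gt_tangent[of "x i" "y i"] pos[of i]
        by (cases "x i = y i") (auto simp: power2_eq_square power3_eq_cube)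
    qed
    show "\<exists>i\<in>I. 3 * y i - 2 * x i < y i ^ 3 / (x i)\<^sup>2"
      using ne pos cube_div_square_gt_tangent by blast
  qed fact
  finally show ?thesis .
qed

lemma is_arg_min_unique:
  fixes f :: "'a \<Rightarrow> 'b::order"
  assumes "P a" "\<And>x. P x \<Longrightarrow> x \<noteq> a \<Longrightarrow> f a < f x"
  shows "{x. is_arg_min f P x} = {a}"
  using assms unfolding is_arg_min_def by (auto dest: less_asym)

theorem proposition3:
  fixes H :: "complex^'u^'r"
    and p c fs bbar :: real
  assumes "p > 0" and "c > 0" and "fs > 0" and "bbar > 0"
    and "\<And>i. norm (row i H) \<noteq> 0"
  shows "{b :: real^'r. is_arg_min (total_quant_error p H) (within_power_budget c fs bbar) b}
    = {\<chi> i. bbar + log 2 (real CARD('r) * norm (row i H) powr (2/3)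
                            / (\<Sum>j\<in>UNIV. norm (row j H) powr (2/3)))}"
    (is "_ = {?opt}")
proof -
  define a where "a = (\<lambda>i. norm (row i H) powr (2/3))"
  define A where "A = sum a UNIV"
  \<comment> \<open>The budget divided by \<open>c * fs\<close>, as a bound on the sum of
    \<open>2 powr (b $ i)\<close>.\<close>
  define S where "S = real CARD('r) * 2 powr bbar"
  define y where "y = (\<lambda>i. S * a i / A)"
  \<comment> \<open>The factor \<open>(A / S) ^ 3\<close> undoes the scaling in \<open>y\<close>:
    the squared norm of row \<open>i\<close> is \<open>a i ^ 3\<close>, and
    \<open>a i = A / S * y i\<close>.\<close>
  define C where "C = pi * sqrt 3 / 2 * p * (A / S) ^ 3"
  have a_pos: "a i > 0" for i
    using assms(5) by (simp add: a_def)
  have A_pos: "A > 0"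
    unfolding A_def by (rule sum_pos) (auto simp: a_pos)
  have S_pos: "S > 0"
    by (simp add: S_def)
  have y_pos: "y i > 0" for i
    using a_pos A_pos S_pos by (simp add: y_def)
  have C_pos: "C > 0"
    using \<open>p > 0\<close> A_pos S_pos by (simp add: C_def)
  have sum_y: "sum y UNIV = S"
    using A_pos by (simp add: y_def A_def flip: sum_distrib_left sum_divide_distrib)
  have opt: "2 powr (?opt $ i) = y i" for i
  proof -
    have "real CARD('r) * a i / A > 0"
      using a_pos A_pos by simp
    then have "2 powr (bbar + log 2 (real CARD('r) * a i / A)) = y i"
      by (simp add: powr_add y_def S_def)
    then show ?thesis
      by (simp add: a_def A_def)
  qed
  have norm_sq: "(norm (row i H))\<^sup>2 = (A / S) ^ 3 * y i ^ 3" for i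
  proof -
    have "(norm (row i H))\<^sup>2 = a i ^ 3"
      using assms(5)[of i] by (simp add: a_def powr_power)
    then show ?thesis
      using A_pos S_pos by (simp add: y_def power_divide power_mult_distrib)
  qed
  have error: "total_quant_error p H b = C * (\<Sum>i\<in>UNIV. y i ^ 3 / (2 powr (b $ i))\<^sup>2)" for b
  proof -
    have "2 powr (- 2 * t) = 1 / (2 powr t)\<^sup>2" for t :: real
      by (simp add: powr_minus powr_power divide_inverse mult.commute)
    then show ?thesis
      unfolding total_quant_error_def quant_error_def signal_variance_def norm_sq sum_distrib_left
      by (simp add: C_def mult_ac)
  qed
  have budget: "within_power_budget c fs bbar b \<longleftrightarrow> (\<Sum>i\<in>UNIV. 2 powr (b $ i)) \<le> sum y UNIV"
    for b :: "real^'r"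
    using \<open>c > 0\<close> \<open>fs > 0\<close>
    by (simp add: within_power_budget_def adc_power_def sum_y S_def mult.left_commute
        flip: sum_distrib_left)
  show ?thesis
  proof (rule is_arg_min_unique)
    show "within_power_budget c fs bbar ?opt"
      unfolding budget opt by simp
  next
    fix b :: "real^'r"
    assume "within_power_budget c fs bbar b" and "b \<noteq> ?opt"
    moreover from \<open>b \<noteq> ?opt\<close> obtain i where "b $ i \<noteq> ?opt $ i"
      unfolding vec_eq_iff by blast
    then have "2 powr (b $ i) \<noteq> y i"
      unfolding opt[symmetric] by (simp only: powr_inj) simp
    ultimately have "sum y UNIV < (\<Sum>i\<in>UNIV. y i ^ 3 / (2 powr (b $ i))\<^sup>2)"
      unfolding budget
      by (intro sum_less_sum_cube_div_square) (auto simp: y_pos)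
    \<comment> \<open>At the optimum each summand collapses to \<open>y i\<close>, so the bound
      \<open>sum y UNIV\<close> is attained there.\<close>
    moreover have "y i ^ 3 / (y i)\<^sup>2 = y i" for i
      using y_pos[of i] by (simp add: power2_eq_square power3_eq_cube)
    ultimately show "total_quant_error p H ?opt < total_quant_error p H b"
      unfolding error opt using C_pos by simp
  qed
qed

end
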